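(* Let $\mathscr{A}$ be a $C^*$-algebra equipped with a $*$-conjugate-automorphism $\sharp$, let $\mathscr{E}$ be a right Hilbert $\mathscr{A}$-module equipped with a $\sharp$-conjugation $C$, and let $U\in\mathbb{L}(\mathscr{E})$ be a $C$-symmetric unitary. Then $U$ is the product of two $\sharp$-conjugations.
   Context: A $*$-conjugate-automorphism on a $C^*$-algebra $\mathscr{A}$ is a map $\sharp:\mathscr{A}\to\mathscr{A}$, $a\mapsto a^\sharp$, such that for all $a,b\in\mathscr{A}$, $\lambda\in\mathbb{C}$: (1) $(\lambda a+b)^\sharp=\bar\lambda a^\sharp+b^\sharp$; (2) $(a^\sharp)^\sharp=a$; (3) $(a^\sharp)^*=(a^* )^\sharp$; (4) $(ab)^\sharp=a^\sharp b^\sharp$. $\mathbb{L}(\mathscr{E})$ is the $C^*$-algebra of adjointable linear operators on $\mathscr{E}$ (inner products are conjugate-linear in the first variable). A $\sharp$-conjugation on $\mathscr{E}$ is a bounded conjugate-linear operator $C:\mathscr{E}\to\mathscr{E}$ with $C^2=I_{\mathscr{E}}$ and $\langle Cx,Cy\rangle=\langle x,y\rangle^\sharp$ for all $x,y\in\mathscr{E}$. $U\in\mathbb{L}(\mathscr{E})$ is $C$-symmetric if $U=CU^*C$. *)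

theory Defs
  imports "HOL-Analysis.Analysis"
begin

class complex_vector = real_vector +
  fixes scaleC :: "complex \<Rightarrow> 'a \<Rightarrow> 'a"  (infixr "*\<^sub>C" 75)
  assumes scaleR_scaleC: "r *\<^sub>R x = complex_of_real r *\<^sub>C x"
    and scaleC_add_right: "c *\<^sub>C (x + y) = c *\<^sub>C x + c *\<^sub>C y"
    and scaleC_add_left: "(c + d) *\<^sub>C x = c *\<^sub>C x + d *\<^sub>C x"
    and scaleC_scaleC: "c *\<^sub>C d *\<^sub>C x = (c * d) *\<^sub>C x"
    and scaleC_one: "1 *\<^sub>C x = x"

class complex_normed_vector = complex_vector + real_normed_vector +
  assumes norm_scaleC: "norm (c *\<^sub>C x) = cmod c * norm x"

class complex_banach = complex_normed_vector + complete_space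

text \<open>Complex $C^*$-algebras; no unit is required.\<close>

class cstar_algebra = complex_banach + real_normed_algebra +
  fixes star :: "'a \<Rightarrow> 'a"
  assumes scaleC_mult_left: "(c *\<^sub>C a) * b = c *\<^sub>C (a * b)"
    and scaleC_mult_right: "a * (c *\<^sub>C b) = c *\<^sub>C (a * b)"
    and star_add: "star (a + b) = star a + star b"
    and star_scaleC: "star (c *\<^sub>C a) = cnj c *\<^sub>C star a"
    and star_star: "star (star a) = a"
    and star_mult: "star (a * b) = star b * star a"
    and cstar_identity: "norm (star a * a) = (norm a)\<^sup>2"

definition cstar_positive :: "'a::cstar_algebra \<Rightarrow> bool" where
  "cstar_positive a \<longleftrightarrow> (\<exists>b. a = star b * b)"

definition star_conjugate_automorphism :: "('a::cstar_algebra \<Rightarrow> 'a) \<Rightarrow> bool" where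
  "star_conjugate_automorphism sharp \<longleftrightarrow>
     (\<forall>c a b. sharp (c *\<^sub>C a + b) = cnj c *\<^sub>C sharp a + sharp b) \<and>
     (\<forall>a. sharp (sharp a) = a) \<and>
     (\<forall>a. star (sharp a) = sharp (star a)) \<and>
     (\<forall>a b. sharp (a * b) = sharp a * sharp b)"

text \<open>
  A right Hilbert module over the type \<open>'a\<close> with underlying space the type \<open>'e\<close>: \<open>act x a\<close> is the
  right action $x a$, \<open>ip x y\<close> the inner product, conjugate-linear in \<open>x\<close>. The class
  \<open>complex_banach\<close> supplies the norm and its completeness; \<open>norm_ip\<close> says that this norm is the
  one given by the inner product. For unital \<open>'a\<close> the axioms imply \<open>act x 1 = x\<close>.
\<close>

locale hilbert_module =
  fixes act :: "'e::complex_banach \<Rightarrow> 'a::cstar_algebra \<Rightarrow> 'e"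
    and ip :: "'e \<Rightarrow> 'e \<Rightarrow> 'a"
  assumes act_add_left: "act (x + y) a = act x a + act y a"
    and act_add_right: "act x (a + b) = act x a + act x b"
    and act_mult: "act x (a * b) = act (act x a) b"
    and act_scaleC_left: "act (c *\<^sub>C x) a = c *\<^sub>C act x a"
    and act_scaleC_right: "act x (c *\<^sub>C a) = c *\<^sub>C act x a"
    and ip_add_right: "ip x (y + z) = ip x y + ip x z"
    and ip_scaleC_right: "ip x (c *\<^sub>C y) = c *\<^sub>C ip x y"
    and ip_act_right: "ip x (act y a) = ip x y * a"
    and ip_star: "star (ip x y) = ip y x"
    and ip_positive: "cstar_positive (ip x x)"
    and ip_definite: "ip x x = 0 \<Longrightarrow> x = 0"
    and norm_ip: "norm x = sqrt (norm (ip x x))"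

definition is_adjoint ::
    "('e \<Rightarrow> 'e \<Rightarrow> 'a) \<Rightarrow> ('e \<Rightarrow> 'e) \<Rightarrow> ('e \<Rightarrow> 'e) \<Rightarrow> bool" where
  "is_adjoint ip T S \<longleftrightarrow> (\<forall>x y. ip (T x) y = ip x (S y))"

text \<open>
  $\mathbb{L}(\mathscr{E})$. Boundedness and linearity over \<open>'a\<close> follow from the existence of an
  adjoint, as does the complex linearity stated here.
\<close>

definition adjointable_operators ::
    "('e::complex_banach \<Rightarrow> 'e \<Rightarrow> 'a::cstar_algebra) \<Rightarrow> ('e \<Rightarrow> 'e) set" where
  "adjointable_operators ip =
     {T. Vector_Spaces.linear scaleC scaleC T \<and> (\<exists>S. is_adjoint ip T S)}"

definition adjoint_op ::
    "('e::complex_banach \<Rightarrow> 'e \<Rightarrow> 'a::cstar_algebra) \<Rightarrow> ('e \<Rightarrow> 'e) \<Rightarrow> ('e \<Rightarrow> 'e)" where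
  "adjoint_op ip T = (THE S. is_adjoint ip T S)"

lemma (in hilbert_module) adjoint_op_eq:
  assumes "is_adjoint ip T S"
  shows "adjoint_op ip T = S"
  unfolding adjoint_op_def
proof (rule the_equality[where P = "is_adjoint ip T", OF assms])
  fix R assume "is_adjoint ip T R"
  show "R = S"
  proof
    fix y
    have "ip x (R y) = ip x (S y)" for x
      using assms \<open>is_adjoint ip T R\<close> by (metis is_adjoint_def)
    moreover have "ip x (R y - S y + S y) = ip x (R y - S y) + ip x (S y)" for x
      by (rule ip_add_right)
    ultimately have "ip (R y - S y) (R y - S y) = 0"
      by simp
    then show "R y = S y"
      using ip_definite by fastforce
  qed
qed

definition unitary_op ::
    "('e::complex_banach \<Rightarrow> 'e \<Rightarrow> 'a::cstar_algebra) \<Rightarrow> ('e \<Rightarrow> 'e) \<Rightarrow> bool" where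
  "unitary_op ip U \<longleftrightarrow>
     U \<in> adjointable_operators ip \<and> adjoint_op ip U \<circ> U = id \<and> U \<circ> adjoint_op ip U = id"

text \<open>Additivity together with the norm bound is contained in real bounded linearity.\<close>

definition bounded_conjugate_linear :: "('e::complex_banach \<Rightarrow> 'e) \<Rightarrow> bool" where
  "bounded_conjugate_linear T \<longleftrightarrow> bounded_linear T \<and> (\<forall>c x. T (c *\<^sub>C x) = cnj c *\<^sub>C T x)"

definition sharp_conjugation ::
    "('a::cstar_algebra \<Rightarrow> 'a) \<Rightarrow> ('e::complex_banach \<Rightarrow> 'e \<Rightarrow> 'a) \<Rightarrow> ('e \<Rightarrow> 'e) \<Rightarrow> bool" where
  "sharp_conjugation sharp ip C \<longleftrightarrow>
     bounded_conjugate_linear C \<and> C \<circ> C = id \<and> (\<forall>x y. ip (C x) (C y) = sharp (ip x y))"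

definition C_symmetric ::
    "('e::complex_banach \<Rightarrow> 'e \<Rightarrow> 'a::cstar_algebra) \<Rightarrow> ('e \<Rightarrow> 'e) \<Rightarrow> ('e \<Rightarrow> 'e) \<Rightarrow> bool" where
  "C_symmetric ip C U \<longleftrightarrow> U = C \<circ> adjoint_op ip U \<circ> C"

end

theory Submission
  imports Defs
begin

text \<open>Since \<open>C\<close> is an involution, \<open>U = (U \<circ> C) \<circ> C\<close>, so
  it is enough that \<open>U \<circ> C\<close> is again a conjugation for \<open>sharp\<close>
  (\<open>sharp_conjugation_unitary_comp\<close>). A unitary preserves \<open>ip\<close>, so
  \<open>U \<circ> C\<close> transforms \<open>ip\<close> as \<open>C\<close> does;
  \<open>C\<close>-symmetry makes it an involution, because it turns \<open>U C\<close> into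
  \<open>C U*\<close>, whence \<open>U C U C = C U* U C = C C = id\<close>.\<close>

lemma (in hilbert_module) unitary_op_ip:
  assumes "unitary_op ip U"
  shows "ip (U x) (U y) = ip x y"
proof -
  obtain S where S: "is_adjoint ip U S"
    using assms by (auto simp: unitary_op_def adjointable_operators_def)
  \<comment> \<open>\<open>adjoint_op\<close> is a definite description; uniqueness of adjoints
    identifies it with the witness \<open>S\<close>.\<close>
  then have "S \<circ> U = id"
    using assms by (simp add: unitary_op_def adjoint_op_eq)
  then have "S (U y) = y"
    by (simp add: pointfree_idE)
  then show ?thesis
    using S by (simp add: is_adjoint_def)
qed

text \<open>The norm comes from \<open>ip\<close>, which \<open>U\<close> preserves, so
  \<open>U\<close> is an isometry and the bound 1 works.\<close>

lemma (in hilbert_module) bounded_linear_unitary_op: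
  assumes "unitary_op ip U"
  shows "bounded_linear U"
proof -
  interpret U: Vector_Spaces.linear scaleC scaleC U
    using assms by (simp add: unitary_op_def adjointable_operators_def)
  show ?thesis
  proof (rule bounded_linear_intro[where K = 1])
    show "norm (U x) \<le> norm x * 1" for x
      using unitary_op_ip[OF assms] by (simp add: norm_ip)
  qed (simp_all add: U.add U.scale scaleR_scaleC)
qed

lemma (in hilbert_module) sharp_conjugation_unitary_comp:
  assumes C: "sharp_conjugation sharp ip C"
    and U: "unitary_op ip U"
    and sym: "C_symmetric ip C U"
  shows "sharp_conjugation sharp ip (U \<circ> C)"
  unfolding sharp_conjugation_def bounded_conjugate_linear_def
proof (intro conjI allI)
  interpret U: Vector_Spaces.linear scaleC scaleC U
    using U by (simp add: unitary_op_def adjointable_operators_def)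
  have "bounded_linear C"
    using C by (simp add: sharp_conjugation_def bounded_conjugate_linear_def)
  then show "bounded_linear (U \<circ> C)"
    using bounded_linear_compose[OF bounded_linear_unitary_op[OF U]] by (simp add: o_def)
  show "(U \<circ> C) (c *\<^sub>C x) = cnj c *\<^sub>C (U \<circ> C) x" for c x
    using C by (simp add: sharp_conjugation_def bounded_conjugate_linear_def U.scale)
  show "ip ((U \<circ> C) x) ((U \<circ> C) y) = sharp (ip x y)" for x y
    using C by (simp add: sharp_conjugation_def unitary_op_ip[OF U])
  have CC: "C (C x) = x" for x
    using C by (simp add: sharp_conjugation_def pointfree_idE)
  \<comment> \<open>Evaluate \<open>U = C U* C\<close> at \<open>C x\<close> and cancel
    \<open>C C\<close>.\<close>
  have UC: "U (C x) = C (adjoint_op ip U x)" for x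
    using sym CC by (metis C_symmetric_def comp_apply)
  have "adjoint_op ip U (U x) = x" for x
    using U by (simp add: unitary_op_def pointfree_idE)
  \<comment> \<open>The instance of \<open>UC\<close> rewrites only the outer \<open>U C\<close>,
    leaving the inner \<open>U\<close> to cancel against \<open>U*\<close>.\<close>
  then show "(U \<circ> C) \<circ> (U \<circ> C) = id"
    using CC by (simp add: fun_eq_iff UC[of "U _"])
qed

theorem corollary5p9:
  fixes act :: "'e::complex_banach \<Rightarrow> 'a::cstar_algebra \<Rightarrow> 'e"
    and ip :: "'e \<Rightarrow> 'e \<Rightarrow> 'a"
    and sharp :: "'a \<Rightarrow> 'a"
    and C U :: "'e \<Rightarrow> 'e"
  assumes "star_conjugate_automorphism sharp"
    and "hilbert_module act ip"
    and "sharp_conjugation sharp ip C"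
    and "U \<in> adjointable_operators ip"
    and "unitary_op ip U"
    and "C_symmetric ip C U"
  shows "\<exists>C1 C2. sharp_conjugation sharp ip C1 \<and> sharp_conjugation sharp ip C2 \<and> U = C1 \<circ> C2"
proof (intro exI conjI)
  interpret hilbert_module act ip
    by (rule assms(2))
  \<comment> \<open>This claim and the next fix the witnesses left open by \<open>exI\<close>:
    \<open>U \<circ> C\<close> and \<open>C\<close>.\<close>
  show "sharp_conjugation sharp ip (U \<circ> C)"
    by (rule sharp_conjugation_unitary_comp[OF assms(3,5,6)])
  show "sharp_conjugation sharp ip C"
    by (rule assms(3))
  then show "U = (U \<circ> C) \<circ> C"
    by (simp add: sharp_conjugation_def comp_assoc)
qed

end
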